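(* Let $I$ be a nonempty finite set of nonnegative integers that is a complete sequence, that is, $I=[\min I,\max I]\cap\mathbb{Z}_+$. Then the minimum number of convex quadratic inequalities needed to represent $I$ as the facial dimension signature of some convex set (i.e., the minimum $K$ such that there is a system of $K$ convex quadratic inequalities in some $\mathbb{R}^N$ whose solution set has facial dimension signature $I$) is $$\lceil\log_2(\max I-\min I+1)\rceil.$$
   Context: $\mathbb{Z}_+$ denotes the set of nonnegative integers. A convex subset $F$ of a convex set $C$ is a face of $C$ if for any $x,y\in C$ whose open segment $(x,y)$ meets $F$ one has $x,y\in F$ (with the convention $(x,x)=\{x\}$). The dimension of a convex set is the dimension of the smallest affine subspace containing it. The facial dimension signature of $C$ is the set $\{\dim F : F \text{ a nonempty face of } C\}$. A convex quadratic inequality in $\mathbb{R}^N$ is an inequality $f(x)\le 0$ with $f(x)=\langle Ax,x\rangle+\langle a,x\rangle+\alpha$, where $A$ is a symmetric positive semidefinite $N\times N$ matrix (possibly zero), $a\in\mathbb{R}^N$, $\alpha\in\mathbb{R}$. The solution set of an empty system is the whole space. *)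

theory Defs
  imports "HOL-Analysis.Analysis" "HOL-Analysis.Finite_Function_Topology"
begin

(* The ambient dimension N is quantified inside the statement, so it cannot be a type. R^N is
   therefore the N-dimensional coordinate subspace of the real vector space of finitely
   supported sequences. This makes the type-class notions (affine hull, dim, face_of) available;
   none of them depends on the larger space in which R^N is embedded. *)
definition Rn :: "nat \<Rightarrow> (nat \<Rightarrow>\<^sub>0 real) set" where
  "Rn N = {x. Poly_Mapping.keys x \<subseteq> {..<N}}"

(* aff_dim is restricted to euclidean_space. The dimension of the affine subspace affine hull F is
   the dimension of its direction space. (dim is 0 on infinite-dimensional spaces, which
   do not occur for subsets of Rn N.) *)
definition dim_convex :: "'a::real_vector set \<Rightarrow> nat" where
  "dim_convex F = dim {x - y | x y. x \<in> affine hull F \<and> y \<in> affine hull F}"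

definition facial_dimension_signature :: "'a::real_vector set \<Rightarrow> nat set" where
  "facial_dimension_signature C = {dim_convex F | F. F face_of C \<and> F \<noteq> {}}"

(* \<langle>Ax, x\<rangle>; here and below only the entries of A and a with indices below N are used. *)
definition quad_form :: "nat \<Rightarrow> (nat \<Rightarrow> nat \<Rightarrow> real) \<Rightarrow> (nat \<Rightarrow>\<^sub>0 real) \<Rightarrow> real" where
  "quad_form N A x =
     (\<Sum>i<N. (\<Sum>j<N. A i j * Poly_Mapping.lookup x j) * Poly_Mapping.lookup x i)"

definition sym_psd :: "nat \<Rightarrow> (nat \<Rightarrow> nat \<Rightarrow> real) \<Rightarrow> bool" where
  "sym_psd N A \<longleftrightarrow> (\<forall>i<N. \<forall>j<N. A i j = A j i) \<and> (\<forall>x\<in>Rn N. 0 \<le> quad_form N A x)"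

(* (A, a, \<alpha>) encodes the inequality \<langle>Ax, x\<rangle> + \<langle>a, x\<rangle> + \<alpha> \<le> 0. *)
type_synonym quadratic = "(nat \<Rightarrow> nat \<Rightarrow> real) \<times> (nat \<Rightarrow> real) \<times> real"

definition convex_quadratic :: "nat \<Rightarrow> quadratic \<Rightarrow> bool" where
  "convex_quadratic N = (\<lambda>(A, a, \<alpha>). sym_psd N A)"

definition quad_eval :: "nat \<Rightarrow> quadratic \<Rightarrow> (nat \<Rightarrow>\<^sub>0 real) \<Rightarrow> real" where
  "quad_eval N = (\<lambda>(A, a, \<alpha>) x.
     quad_form N A x + (\<Sum>i<N. a i * Poly_Mapping.lookup x i) + \<alpha>)"

definition solution_set :: "nat \<Rightarrow> quadratic list \<Rightarrow> (nat \<Rightarrow>\<^sub>0 real) set" where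
  "solution_set N qs = {x \<in> Rn N. \<forall>q\<in>set qs. quad_eval N q x \<le> 0}"

(* N = 0 is allowed: the signature {0} is represented by the empty system in R^0. *)
definition representable_by :: "nat \<Rightarrow> nat set \<Rightarrow> bool" where
  "representable_by K I \<longleftrightarrow>
     (\<exists>N qs. length qs = K \<and> (\<forall>q\<in>set qs. convex_quadratic N q) \<and>
             facial_dimension_signature (solution_set N qs) = I)"

lemma dim_convex_eq_aff_dim:
  fixes F :: "'a::euclidean_space set"
  assumes "F \<noteq> {}"
  shows "aff_dim F = int (dim_convex F)"
proof -
  obtain a where a: "a \<in> affine hull F"
    using assms hull_inc by fastforce
  have "{x - y | x y. x \<in> affine hull F \<and> y \<in> affine hull F} = (+) (- a) ` (affine hull F)"
    (is "?D = ?T")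
  proof
    show "?T \<subseteq> ?D"
      using a by (force simp: algebra_simps)
    show "?D \<subseteq> ?T"
    proof
      fix z assume "z \<in> ?D"
      then obtain x y where xy: "z = x - y" "x \<in> affine hull F" "y \<in> affine hull F"
        by blast
      have "a + 1 *\<^sub>R (x - y) \<in> affine hull F"
        using mem_affine_3_minus[OF affine_affine_hull a xy(2,3)] .
      then show "z \<in> ?T"
        using xy(1) by (force intro!: image_eqI[where x = "a + (x - y)"])
    qed
  qed
  moreover have "aff_dim (affine hull F) = int (dim ((+) (- a) ` (affine hull F)))"
    using a by (intro aff_dim_eq_dim) (simp add: hull_hull)
  ultimately show ?thesis
    by (simp add: dim_convex_def)
qed

end

theory Submission
  imports Defs
begin

text \<open>
  \<^emph>\<open>Faces see only the active inequalities.\<close> Let \<^term>\<open>C\<close> be the solution set of convex quadratic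
  inequalities \<open>f i x \<le> 0\<close>. On a line, a quadratic function differs from its chords by
  exactly \<open>u (1 - u)\<close> times its quadratic part. Hence if \<open>f i\<close> is nonpositive at both ends of a segment
  and zero somewhere inside, it is zero on the whole segment and its quadratic part vanishes in the
  direction of the segment; by positive semidefiniteness \<open>f i\<close> is then constant along this
  direction everywhere in space. So the directions in which one can move both ways from a point
  \<open>x\<close> without leaving \<open>C\<close> are those along which every \<open>f i\<close> with \<open>f i x = 0\<close> is constant, and
  the face of \<open>C\<close> that has \<open>x\<close> in its relative interior spans exactly these directions. The
  facial dimension signature therefore consists of the dimensions of the common constancy spaces of
  the active sets that occur (\<open>facial_dimension_signature_solution_set\<close>).

  \<^emph>\<open>Lower bound.\<close> \<open>K\<close> inequalities have at most \<open>2 ^ K\<close> sets of active inequalities, hence a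
  signature with at most \<open>2 ^ K\<close> elements.

  \<^emph>\<open>Upper bound.\<close> In a product of balls and a linear space, the dimension of a face is the dimension
  of the linear space plus a subset sum of the dimensions of the balls. With \<open>K\<close> balls
  every interval \<open>{m..M}\<close> with \<open>M - m < 2 ^ K\<close> arises: the last ball takes half (rounded up)
  of the \<open>M - m\<close> coordinates of the balls, and the others are distributed in the same way
  (\<open>interval_colouring\<close>).
\<close>

section \<open>Quadratic functions along lines\<close>

lemma Rn_iff: "x \<in> Rn N \<longleftrightarrow> (\<forall>j\<ge>N. Poly_Mapping.lookup x j = 0)"
  unfolding Rn_def subset_iff mem_Collect_eq in_keys_iff lessThan_iff by (metis not_less)

lemma lookup_scaleR [simp]:
  "Poly_Mapping.lookup (t *\<^sub>R x) i = t *\<^sub>R Poly_Mapping.lookup x i"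
  unfolding scaleR_poly_mapping_def
  by (subst lookup_Abs_poly_mapping)
    (auto intro: finite_subset[OF _ finite_lookup[of x]])

lemma subspace_Rn: "subspace (Rn N)"
  by (auto simp: subspace_def Rn_iff lookup_add)

definition polar_form :: "nat \<Rightarrow> (nat \<Rightarrow> nat \<Rightarrow> real) \<Rightarrow> (nat \<Rightarrow>\<^sub>0 real) \<Rightarrow> (nat \<Rightarrow>\<^sub>0 real) \<Rightarrow> real" where
  "polar_form N A x v =
     (\<Sum>i<N. (\<Sum>j<N. A i j * Poly_Mapping.lookup v j) * Poly_Mapping.lookup x i
           + (\<Sum>j<N. A i j * Poly_Mapping.lookup x j) * Poly_Mapping.lookup v i)"

lemma quad_form_along_line:
  "quad_form N A (x + t *\<^sub>R v) = quad_form N A x + t * polar_form N A x v + t\<^sup>2 * quad_form N A v"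
proof -
  let ?A = "\<lambda>i y. \<Sum>j<N. A i j * Poly_Mapping.lookup y j"
  have lin: "?A i (x + t *\<^sub>R v) = ?A i x + t * ?A i v" for i
    by (simp add: lookup_add distrib_left sum.distrib sum_distrib_left mult.left_commute)
  have "?A i (x + t *\<^sub>R v) * Poly_Mapping.lookup (x + t *\<^sub>R v) i =
      ?A i x * Poly_Mapping.lookup x i
      + t * (?A i v * Poly_Mapping.lookup x i + ?A i x * Poly_Mapping.lookup v i)
      + t\<^sup>2 * (?A i v * Poly_Mapping.lookup v i)" for i
    unfolding lin by (simp add: lookup_add algebra_simps power2_eq_square)
  then show ?thesis
    by (simp only: quad_form_def polar_form_def sum.distrib sum_distrib_left[symmetric])
qed

lemma quad_eval_along_line:
  "quad_eval N (A, a, \<alpha>) (x + t *\<^sub>R v) = quad_eval N (A, a, \<alpha>) x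
     + t * (polar_form N A x v + (\<Sum>i<N. a i * Poly_Mapping.lookup v i)) + t\<^sup>2 * quad_form N A v"
proof -
  have "(\<Sum>i<N. a i * Poly_Mapping.lookup (x + t *\<^sub>R v) i) =
      (\<Sum>i<N. a i * Poly_Mapping.lookup x i) + t * (\<Sum>i<N. a i * Poly_Mapping.lookup v i)"
    by (simp add: lookup_add distrib_left sum.distrib sum_distrib_left mult.left_commute)
  then show ?thesis
    by (simp add: quad_eval_def quad_form_along_line distrib_left)
qed

lemma quad_eval_convex_comb:
  "quad_eval N (A, a, \<alpha>) ((1 - u) *\<^sub>R x + u *\<^sub>R y) =
     (1 - u) * quad_eval N (A, a, \<alpha>) x + u * quad_eval N (A, a, \<alpha>) y
     - u * (1 - u) * quad_form N A (y - x)"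
proof -
  have "(1 - u) *\<^sub>R x + u *\<^sub>R y = x + u *\<^sub>R (y - x)"
    by (simp add: algebra_simps)
  moreover have "y = x + 1 *\<^sub>R (y - x)"
    by simp
  ultimately show ?thesis
    using quad_eval_along_line[of N A a \<alpha> x u "y - x"] quad_eval_along_line[of N A a \<alpha> x 1 "y - x"]
    by (simp add: power2_eq_square algebra_simps)
qed

lemma affine_nonneg_imp_slope_zero:
  fixes b c :: real
  assumes "\<And>t. 0 \<le> c + t * b"
  shows "b = 0"
proof (rule ccontr)
  assume "b \<noteq> 0"
  then have "c + (- (c + 1) / b) * b = -1"
    by (simp add: field_simps)
  then show False
    using assms[of "- (c + 1) / b"] by linarith
qed

text \<open>
  Along a line in a direction \<open>v\<close> on which the form vanishes, the form is affine with slope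
  \<open>polar_form N A y v\<close>, and an affine function is bounded below only if its slope is 0.
\<close>

lemma psd_polar_form_zero:
  assumes "sym_psd N A" "v \<in> Rn N" "quad_form N A v = 0" "y \<in> Rn N"
  shows "polar_form N A y v = 0"
proof (rule affine_nonneg_imp_slope_zero)
  fix t
  have "y + t *\<^sub>R v \<in> Rn N"
    using assms subspace_Rn by (simp add: subspace_add subspace_mul)
  then show "0 \<le> quad_form N A y + t * polar_form N A y v"
    using assms(1,3) quad_form_along_line[of N A y t v] by (auto simp: sym_psd_def)
qed

definition constancy_space :: "nat \<Rightarrow> quadratic set \<Rightarrow> (nat \<Rightarrow>\<^sub>0 real) set" where
  "constancy_space N Q =
     {v \<in> Rn N. \<forall>q\<in>Q. \<forall>x\<in>Rn N. \<forall>t. quad_eval N q (x + t *\<^sub>R v) = quad_eval N q x}"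

lemma subspace_constancy_space: "subspace (constancy_space N Q)"
proof (rule subspaceI)
  show "0 \<in> constancy_space N Q"
    using subspace_Rn by (simp add: constancy_space_def subspace_0)
next
  fix v w assume v: "v \<in> constancy_space N Q" and w: "w \<in> constancy_space N Q"
  have "quad_eval N q (x + t *\<^sub>R (v + w)) = quad_eval N q x" if "q \<in> Q" "x \<in> Rn N" for q x t
  proof -
    have "x + t *\<^sub>R v \<in> Rn N"
      using that v subspace_Rn by (simp add: constancy_space_def subspace_add subspace_mul)
    then show ?thesis
      using that v w by (simp add: constancy_space_def scaleR_add_right flip: add.assoc)
  qed
  then show "v + w \<in> constancy_space N Q"
    using v w subspace_Rn by (simp add: constancy_space_def subspace_add)
next
  fix c :: real and v assume "v \<in> constancy_space N Q"
  then show "c *\<^sub>R v \<in> constancy_space N Q"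
    using subspace_Rn by (simp add: constancy_space_def subspace_mul)
qed

text \<open>
  The chord identity writes the value 0 inside the segment as a sum of three nonpositive terms, so
  all three vanish. That constancy then holds along parallels through every point uses
  positive semidefiniteness and fails for general convex functions.
\<close>

lemma zero_inside_segment:
  assumes q: "convex_quadratic N q" and x: "x \<in> Rn N" and y: "y \<in> Rn N"
    and u: "0 < u" "u < 1"
    and le: "quad_eval N q x \<le> 0" "quad_eval N q y \<le> 0"
    and zero: "quad_eval N q ((1 - u) *\<^sub>R x + u *\<^sub>R y) = 0"
  shows "quad_eval N q x = 0" and "quad_eval N q y = 0" and "y - x \<in> constancy_space N {q}"
proof -
  obtain A a \<alpha> where qe: "q = (A, a, \<alpha>)"
    by (cases q)
  have psd: "sym_psd N A"
    using q by (simp add: convex_quadratic_def qe)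
  have d: "y - x \<in> Rn N"
    using x y subspace_Rn by (simp add: subspace_diff)
  then have nonneg: "0 \<le> quad_form N A (y - x)"
    using psd by (simp add: sym_psd_def)
  have terms: "(1 - u) * quad_eval N q x \<le> 0" "u * quad_eval N q y \<le> 0"
      "0 \<le> u * (1 - u) * quad_form N A (y - x)"
    using u le nonneg by (simp_all add: mult_nonneg_nonpos)
  have "(1 - u) * quad_eval N q x + u * quad_eval N q y - u * (1 - u) * quad_form N A (y - x) = 0"
    using zero quad_eval_convex_comb[of N A a \<alpha> u x y] by (simp add: qe)
  then have "(1 - u) * quad_eval N q x = 0" "u * quad_eval N q y = 0"
      "u * (1 - u) * quad_form N A (y - x) = 0"
    using terms by linarith+
  then show fx: "quad_eval N q x = 0" and fy: "quad_eval N q y = 0"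
    using u by simp_all
  have flat: "quad_form N A (y - x) = 0"
    using \<open>u * (1 - u) * quad_form N A (y - x) = 0\<close> u by simp
  have polar: "polar_form N A z (y - x) = 0" if "z \<in> Rn N" for z
    using psd_polar_form_zero[OF psd d flat that] .
  have lin: "(\<Sum>i<N. a i * Poly_Mapping.lookup (y - x) i) = 0"
    using quad_eval_along_line[of N A a \<alpha> x 1 "y - x"] fx fy flat polar[OF x] by (simp add: qe)
  show "y - x \<in> constancy_space N {q}"
    using d by (simp add: constancy_space_def qe quad_eval_along_line flat polar lin)
qed

section \<open>The signature in terms of active inequalities\<close>

definition active :: "nat \<Rightarrow> quadratic list \<Rightarrow> (nat \<Rightarrow>\<^sub>0 real) \<Rightarrow> quadratic set" where
  "active N qs x = {q \<in> set qs. quad_eval N q x = 0}"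

lemma constancy_space_UN: "v \<in> constancy_space N Q \<longleftrightarrow> v \<in> Rn N \<and> (\<forall>q\<in>Q. v \<in> constancy_space N {q})"
  by (simp only: constancy_space_def mem_Collect_eq ball_simps simp_thms) blast

lemma convex_solution_set:
  assumes "\<forall>q\<in>set qs. convex_quadratic N q"
  shows "convex (solution_set N qs)"
  unfolding convex_alt
proof (intro ballI allI impI)
  fix x y and u :: real
  assume x: "x \<in> solution_set N qs" and y: "y \<in> solution_set N qs" and u: "0 \<le> u \<and> u \<le> 1"
  have "quad_eval N q ((1 - u) *\<^sub>R x + u *\<^sub>R y) \<le> 0" if "q \<in> set qs" for q
  proof -
    obtain A a \<alpha> where qe: "q = (A, a, \<alpha>)"
      by (cases q)
    have "sym_psd N A"
      using assms that by (auto simp: convex_quadratic_def qe)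
    moreover have "y - x \<in> Rn N"
      using x y subspace_Rn by (simp add: subspace_diff solution_set_def)
    ultimately have "0 \<le> quad_form N A (y - x)"
      by (simp add: sym_psd_def)
    then have "0 \<le> u * (1 - u) * quad_form N A (y - x)"
      using u by simp
    moreover have "quad_eval N q x \<le> 0" "quad_eval N q y \<le> 0"
      using x y that by (auto simp: solution_set_def)
    then have "(1 - u) * quad_eval N q x \<le> 0" "u * quad_eval N q y \<le> 0"
      using u by (simp_all add: mult_nonneg_nonpos)
    ultimately show ?thesis
      unfolding qe quad_eval_convex_comb by linarith
  qed
  then show "(1 - u) *\<^sub>R x + u *\<^sub>R y \<in> solution_set N qs"
    using x y subspace_Rn by (simp add: solution_set_def subspace_add subspace_mul)
qed

text \<open>
  The active inequalities do not change along the constancy space, and the inactive ones are strict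
  and hence survive a small step by continuity.
\<close>

lemma move_both_ways:
  assumes x: "x \<in> solution_set N qs" and v: "v \<in> constancy_space N (active N qs x)"
  obtains e where "e > 0" "x + e *\<^sub>R v \<in> solution_set N qs" "x + (- e) *\<^sub>R v \<in> solution_set N qs"
proof -
  have "\<forall>\<^sub>F t in at (0::real). quad_eval N q (x + t *\<^sub>R v) \<le> 0" if q: "q \<in> set qs" for q
  proof (cases "quad_eval N q x = 0")
    case True
    then have "q \<in> active N qs x"
      using q by (simp add: active_def)
    then have "quad_eval N q (x + t *\<^sub>R v) = quad_eval N q x" for t
      using v x unfolding constancy_space_def solution_set_def by blast
    then have "quad_eval N q (x + t *\<^sub>R v) \<le> 0" for t
      by (simp add: True)
    then show ?thesis
      by simp
  next
    case False
    then have neg: "quad_eval N q x < 0"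
      using q x by (force simp: solution_set_def)
    obtain A a \<alpha> where qe: "q = (A, a, \<alpha>)"
      by (cases q)
    have "((\<lambda>t. quad_eval N q (x + t *\<^sub>R v)) \<longlongrightarrow> quad_eval N q x) (at 0)"
      unfolding qe quad_eval_along_line by (auto intro!: tendsto_eq_intros)
    then have "\<forall>\<^sub>F t in at 0. quad_eval N q (x + t *\<^sub>R v) < 0"
      using neg by (rule order_tendstoD)
    then show ?thesis
      by (rule eventually_mono) simp
  qed
  then have "\<forall>\<^sub>F t in at (0::real). \<forall>q\<in>set qs. quad_eval N q (x + t *\<^sub>R v) \<le> 0"
    by (simp add: eventually_ball_finite)
  then obtain d where d: "d > 0"
    and le: "\<And>t q. t \<noteq> 0 \<Longrightarrow> dist t 0 < d \<Longrightarrow> q \<in> set qs \<Longrightarrow> quad_eval N q (x + t *\<^sub>R v) \<le> 0"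
    unfolding eventually_at by blast
  have Rn: "x + t *\<^sub>R v \<in> Rn N" for t
    using x v subspace_Rn by (simp add: solution_set_def constancy_space_def subspace_add subspace_mul)
  have "x + t *\<^sub>R v \<in> solution_set N qs" if "t \<noteq> 0" "dist t 0 < d" for t
    using Rn le that by (simp add: solution_set_def)
  from this[of "d / 2"] this[of "- (d / 2)"] show thesis
    using that[of "d / 2"] d by (simp add: dist_real_def)
qed

text \<open>
  A face that contains an inner point of a segment of the convex set contains the whole segment, so
  \<open>F\<close> contains short segments around \<open>x\<close> in all directions of the constancy space. The last
  assumption says that these are all directions of \<open>F\<close>, that is, \<open>x\<close> is a relative interior point.
\<close>

lemma dim_convex_face:
  assumes F: "F face_of solution_set N qs" and x: "x \<in> F"
    and sub: "\<And>y. y \<in> F \<Longrightarrow> y - x \<in> constancy_space N (active N qs x)"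
  shows "dim_convex F = dim (constancy_space N (active N qs x))"
proof -
  let ?L = "constancy_space N (active N qs x)"
  have L: "subspace ?L"
    by (rule subspace_constancy_space)
  have xC: "x \<in> solution_set N qs"
    using F x by (auto simp: face_of_def)
  have "affine ((+) x ` ?L)"
    using L by (simp add: affine_translation[symmetric] subspace_imp_affine)
  moreover have "F \<subseteq> (+) x ` ?L"
    using sub by (force intro!: image_eqI[where x = "y - x" for y])
  ultimately have hull: "affine hull F \<subseteq> (+) x ` ?L"
    by (rule hull_minimal[rotated])
  have "{a - b |a b. a \<in> affine hull F \<and> b \<in> affine hull F} = ?L"
  proof (intro equalityI subsetI)
    fix w assume "w \<in> {a - b |a b. a \<in> affine hull F \<and> b \<in> affine hull F}"
    then obtain a b where "w = a - b" "a \<in> (+) x ` ?L" "b \<in> (+) x ` ?L"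
      using hull by blast
    then show "w \<in> ?L"
      using L by (auto simp: subspace_diff)
  next
    fix v assume v: "v \<in> ?L"
    have "x + v \<in> affine hull F"
    proof (cases "v = 0")
      case True
      then show ?thesis
        using x by (simp add: hull_inc)
    next
      case False
      obtain e where e: "e > 0" "x + e *\<^sub>R v \<in> solution_set N qs" "x + (- e) *\<^sub>R v \<in> solution_set N qs"
        using move_both_ways[OF xC v] .
      have "x = (1 - 1/2) *\<^sub>R (x + e *\<^sub>R v) + (1/2) *\<^sub>R (x + (- e) *\<^sub>R v)"
        by (simp add: algebra_simps flip: scaleR_add_left)
      moreover have "x + e *\<^sub>R v \<noteq> x + (- e) *\<^sub>R v"
      proof
        assume "x + e *\<^sub>R v = x + (- e) *\<^sub>R v"
        then have "(2 * e) *\<^sub>R v = 0"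
          by (simp only: mult_2 scaleR_add_left) simp
        then show False
          using e False by simp
      qed
      ultimately have "x \<in> open_segment (x + e *\<^sub>R v) (x + (- e) *\<^sub>R v)"
        unfolding in_segment by (intro conjI exI[of _ "1/2"]) auto
      then have "x + e *\<^sub>R v \<in> F"
        using F x e unfolding face_of_def by blast
      then have "(1 - 1 / e) *\<^sub>R x + (1 / e) *\<^sub>R (x + e *\<^sub>R v) \<in> affine hull F"
        using x by (intro mem_affine affine_affine_hull) (auto simp: hull_inc)
      also have "(1 - 1 / e) *\<^sub>R x + (1 / e) *\<^sub>R (x + e *\<^sub>R v) = x + v"
        using e by (simp add: algebra_simps)
      finally show ?thesis .
    qed
    then show "v \<in> {a - b |a b. a \<in> affine hull F \<and> b \<in> affine hull F}"
      using x by (force intro: hull_inc)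
  qed
  then show ?thesis
    by (simp add: dim_convex_def)
qed

text \<open>
  A point of \<open>F\<close> with the fewest active inequalities serves as a relative interior point: at the
  midpoint between it and any other point of \<open>F\<close> the same inequalities must be active.
\<close>

lemma dim_convex_face_active:
  assumes qs: "\<forall>q\<in>set qs. convex_quadratic N q"
    and F: "F face_of solution_set N qs" and ne: "F \<noteq> {}"
  obtains x where "x \<in> solution_set N qs" "dim_convex F = dim (constancy_space N (active N qs x))"
proof -
  obtain x where x: "x \<in> F" and min: "\<And>z. z \<in> F \<Longrightarrow> card (active N qs x) \<le> card (active N qs z)"
    using ne ex_has_least_nat[of "\<lambda>x. x \<in> F" _ "\<lambda>x. card (active N qs x)"] by blast
  have FC: "F \<subseteq> solution_set N qs" and "convex F"
    using F by (auto simp: face_of_def)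
  have "y - x \<in> constancy_space N (active N qs x)" if y: "y \<in> F" for y
  proof -
    define z where "z = (1 - 1/2) *\<^sub>R x + (1/2::real) *\<^sub>R y"
    have C: "x \<in> solution_set N qs" "y \<in> solution_set N qs"
      using x y FC by auto
    have z: "z \<in> F"
      unfolding z_def using \<open>convex F\<close> x y by (intro convexD_alt) auto
    have seg: "quad_eval N q x = 0" "y - x \<in> constancy_space N {q}" if "q \<in> active N qs z" for q
      using zero_inside_segment[of N q x y "1/2"] that qs C
      by (auto simp: active_def solution_set_def z_def)
    have "active N qs z \<subseteq> active N qs x"
      using seg(1) by (auto simp: active_def)
    then have "active N qs z = active N qs x"
      using min[OF z] by (intro card_seteq) (auto simp: active_def)
    moreover have "y - x \<in> Rn N"
      using C subspace_Rn by (simp add: solution_set_def subspace_diff)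
    ultimately show ?thesis
      using seg(2) by (subst constancy_space_UN) simp
  qed
  then show thesis
    using that[of x] dim_convex_face[OF F x] x FC by blast
qed

text \<open>
  This is the smallest face through \<open>x\<close>. Every inequality active at \<open>x\<close> remains active on it, so a segment of
  the solution set with an inner point in it has its direction in the constancy space.
\<close>

lemma face_of_active:
  assumes qs: "\<forall>q\<in>set qs. convex_quadratic N q" and x: "x \<in> solution_set N qs"
  shows "{y \<in> solution_set N qs. y - x \<in> constancy_space N (active N qs x)} face_of solution_set N qs"
    (is "?F face_of ?C")
proof -
  let ?L = "constancy_space N (active N qs x)"
  have L: "subspace ?L"
    by (rule subspace_constancy_space)
  have "?F = ?C \<inter> (+) x ` ?L"
    by (force intro!: image_eqI[where x = "y - x" for y])
  moreover have "convex ((+) x ` ?L)"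
    using L by (simp add: subspace_imp_convex convex_translation)
  ultimately have "convex ?F"
    using convex_solution_set[OF qs] by (simp add: convex_Int)
  moreover have "a \<in> ?F \<and> b \<in> ?F"
    if a: "a \<in> ?C" and b: "b \<in> ?C" and z: "z \<in> ?F" and seg: "z \<in> open_segment a b" for a b z
  proof -
    obtain u where u: "0 < u" "u < 1" and zu: "z = (1 - u) *\<^sub>R a + u *\<^sub>R b"
      using seg by (auto simp: in_segment)
    have dR: "b - a \<in> Rn N"
      using a b subspace_Rn by (simp add: solution_set_def subspace_diff)
    have "b - a \<in> constancy_space N {q}" if q: "q \<in> active N qs x" for q
    proof -
      have "quad_eval N q (x + 1 *\<^sub>R (z - x)) = quad_eval N q x"
        using z q x unfolding constancy_space_def solution_set_def by blast
      then have "quad_eval N q z = 0"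
        using q by (simp add: active_def)
      then show ?thesis
        using zero_inside_segment(3)[of N q a b u] q qs a b u zu
        by (auto simp: active_def solution_set_def)
    qed
    then have d: "b - a \<in> ?L"
      using dR by (subst constancy_space_UN) blast
    have "a - x = (z - x) - u *\<^sub>R (b - a)" "b - x = (z - x) + (1 - u) *\<^sub>R (b - a)"
      by (simp_all add: zu algebra_simps)
    moreover have "z - x \<in> ?L"
      using z by simp
    ultimately have "a - x \<in> ?L" "b - x \<in> ?L"
      using L d by (simp_all only: subspace_diff subspace_add subspace_mul)
    then show ?thesis
      using a b by simp
  qed
  ultimately show ?thesis
    unfolding face_of_def by blast
qed

lemma facial_dimension_signature_solution_set:
  assumes qs: "\<forall>q\<in>set qs. convex_quadratic N q"
  shows "facial_dimension_signature (solution_set N qs) =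
           (\<lambda>x. dim (constancy_space N (active N qs x))) ` solution_set N qs"
proof (intro equalityI subsetI)
  fix d assume "d \<in> facial_dimension_signature (solution_set N qs)"
  then obtain F where "d = dim_convex F" "F face_of solution_set N qs" "F \<noteq> {}"
    by (auto simp: facial_dimension_signature_def)
  then show "d \<in> (\<lambda>x. dim (constancy_space N (active N qs x))) ` solution_set N qs"
    using dim_convex_face_active[OF qs] by blast
next
  fix d assume "d \<in> (\<lambda>x. dim (constancy_space N (active N qs x))) ` solution_set N qs"
  then obtain x where x: "x \<in> solution_set N qs" and d: "d = dim (constancy_space N (active N qs x))"
    by blast
  let ?F = "{y \<in> solution_set N qs. y - x \<in> constancy_space N (active N qs x)}"
  have "x \<in> ?F"
    using x subspace_constancy_space by (simp add: subspace_0)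
  moreover have "dim_convex ?F = d"
    using dim_convex_face[OF face_of_active[OF qs x] \<open>x \<in> ?F\<close>] d by simp
  ultimately show "d \<in> facial_dimension_signature (solution_set N qs)"
    using face_of_active[OF qs x] unfolding facial_dimension_signature_def by blast
qed

text \<open>Each set of active inequalities contributes a single dimension.\<close>

lemma card_representable_by:
  assumes "representable_by K I"
  shows "card I \<le> 2 ^ K"
proof -
  obtain N qs where len: "length qs = K" and qs: "\<forall>q\<in>set qs. convex_quadratic N q"
    and I: "facial_dimension_signature (solution_set N qs) = I"
    using assms by (auto simp: representable_by_def)
  have "I \<subseteq> (\<lambda>Q. dim (constancy_space N Q)) ` Pow (set qs)"
    unfolding I[symmetric] facial_dimension_signature_solution_set[OF qs]
    by (auto simp: active_def)
  then have "card I \<le> card (Pow (set qs))"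
    by (rule surj_card_le[rotated]) simp
  also have "\<dots> \<le> 2 ^ K"
    unfolding card_Pow[OF finite_set] len[symmetric] by (simp add: card_length)
  finally show ?thesis .
qed

section \<open>Products of balls\<close>

lemma dim_coordinate_subspace:
  assumes "finite S"
  shows "dim {x :: nat \<Rightarrow>\<^sub>0 real. \<forall>j. j \<notin> S \<longrightarrow> Poly_Mapping.lookup x j = 0} = card S"
proof -
  let ?e = "\<lambda>i. Poly_Mapping.single i (1::real)"
  have lookup_lincomb: "Poly_Mapping.lookup (\<Sum>i\<in>S. c i *\<^sub>R ?e i) j = (if j \<in> S then c j else 0)" for c j
    using assms by (simp add: lookup_sum lookup_single when_def if_distrib cong: if_cong)
  have inj: "inj_on ?e S"
    by (auto simp: inj_on_def) (metis keys_single singleton_inject zero_neq_one)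
  have "independent (?e ` S)"
  proof (rule independent_if_scalars_zero)
    fix f i assume sum: "(\<Sum>x\<in>?e ` S. f x *\<^sub>R x) = 0" and "i \<in> ?e ` S"
    then obtain j where j: "j \<in> S" "i = ?e j"
      by blast
    have "(\<Sum>i\<in>S. f (?e i) *\<^sub>R ?e i) = 0"
      using sum by (simp add: sum.reindex[OF inj])
    then show "f i = 0"
      using lookup_lincomb[of "\<lambda>i. f (?e i)" j] j by simp
  qed (use assms in simp)
  moreover have "span (?e ` S) = {x. \<forall>j. j \<notin> S \<longrightarrow> Poly_Mapping.lookup x j = 0}" (is "_ = ?V")
  proof
    have "subspace ?V"
      by (auto simp: subspace_def lookup_add)
    moreover have "?e ` S \<subseteq> ?V"
      by (auto simp: lookup_single when_def)
    ultimately show "span (?e ` S) \<subseteq> ?V"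
      by (rule span_minimal[rotated])
    show "?V \<subseteq> span (?e ` S)"
    proof
      fix x assume x: "x \<in> ?V"
      have "x = (\<Sum>i\<in>S. Poly_Mapping.lookup x i *\<^sub>R ?e i)"
        using x by (intro poly_mapping_eqI) (simp add: lookup_lincomb)
      also have "\<dots> \<in> span (?e ` S)"
        by (intro span_sum span_mul span_base) auto
      finally show "x \<in> span (?e ` S)" .
    qed
  qed
  ultimately have "dim {x :: nat \<Rightarrow>\<^sub>0 real. \<forall>j. j \<notin> S \<longrightarrow> Poly_Mapping.lookup x j = 0} = card (?e ` S)"
    by (metis dim_span_eq_card_independent)
  then show ?thesis
    by (simp add: card_image[OF inj])
qed

text \<open>
  A colouring \<open>c\<close> of the coordinates makes each colour class the coordinates of one factor. The
  unit ball over an empty class is the trivially true inequality \<open>-1 \<le> 0\<close>.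
\<close>

definition ball_quadratic :: "(nat \<Rightarrow> nat) \<Rightarrow> nat \<Rightarrow> quadratic" where
  "ball_quadratic c i = ((\<lambda>j k. if j = k \<and> c j = i then 1 else 0), (\<lambda>_. 0), - 1)"

lemma quad_form_ball:
  "quad_form N (\<lambda>j k. if j = k \<and> c j = i then 1 else 0) x =
     (\<Sum>j | j < N \<and> c j = i. (Poly_Mapping.lookup x j)\<^sup>2)"
proof -
  have "(\<Sum>k<N. (if j = k \<and> c j = i then 1 else 0) * Poly_Mapping.lookup x k) * Poly_Mapping.lookup x j
      = (if c j = i then (Poly_Mapping.lookup x j)\<^sup>2 else 0)" if "j < N" for j
    using that by (auto simp: power2_eq_square if_distrib[of "\<lambda>t. t * _"] cong: if_cong)
  then have "quad_form N (\<lambda>j k. if j = k \<and> c j = i then 1 else 0) x =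
      (\<Sum>j<N. if c j = i then (Poly_Mapping.lookup x j)\<^sup>2 else 0)"
    by (simp add: quad_form_def)
  also have "\<dots> = (\<Sum>j\<in>{j \<in> {..<N}. c j = i}. (Poly_Mapping.lookup x j)\<^sup>2)"
    by (rule sum.inter_filter[symmetric]) simp
  finally show ?thesis
    by simp
qed

lemma quad_eval_ball:
  "quad_eval N (ball_quadratic c i) x = (\<Sum>j | j < N \<and> c j = i. (Poly_Mapping.lookup x j)\<^sup>2) - 1"
  unfolding quad_eval_def ball_quadratic_def split_conv quad_form_ball by simp

lemma convex_quadratic_ball: "convex_quadratic N (ball_quadratic c i)"
  unfolding convex_quadratic_def ball_quadratic_def split_conv sym_psd_def quad_form_ball
  by (auto intro: sum_nonneg)

lemma constancy_space_balls:
  "constancy_space N (ball_quadratic c ` J) =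
     {v. \<forall>j. j \<notin> {j. j < N \<and> c j \<notin> J} \<longrightarrow> Poly_Mapping.lookup v j = 0}"
proof (intro equalityI subsetI)
  fix v assume v: "v \<in> constancy_space N (ball_quadratic c ` J)"
  have "Poly_Mapping.lookup v j = 0" if "j < N" "c j \<in> J" for j
  proof -
    have "quad_eval N (ball_quadratic c (c j)) (0 + 1 *\<^sub>R v) = quad_eval N (ball_quadratic c (c j)) 0"
      using v that subspace_0[OF subspace_Rn] unfolding constancy_space_def by blast
    then have "(\<Sum>k | k < N \<and> c k = c j. (Poly_Mapping.lookup v k)\<^sup>2) = 0"
      by (simp add: quad_eval_ball)
    then show ?thesis
      using that by (simp add: sum_nonneg_eq_0_iff)
  qed
  moreover have "v \<in> Rn N"
    using v by (simp add: constancy_space_def)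
  ultimately show "v \<in> {v. \<forall>j. j \<notin> {j. j < N \<and> c j \<notin> J} \<longrightarrow> Poly_Mapping.lookup v j = 0}"
    by (auto simp: Rn_iff not_less[symmetric])
next
  fix v :: "nat \<Rightarrow>\<^sub>0 real"
  assume v: "v \<in> {v. \<forall>j. j \<notin> {j. j < N \<and> c j \<notin> J} \<longrightarrow> Poly_Mapping.lookup v j = 0}"
  then have "v \<in> Rn N"
    by (auto simp: Rn_iff)
  moreover have "quad_eval N (ball_quadratic c i) (x + t *\<^sub>R v) = quad_eval N (ball_quadratic c i) x"
    if "i \<in> J" for i x t
    using v that by (auto simp: quad_eval_ball lookup_add intro!: sum.cong)
  ultimately show "v \<in> constancy_space N (ball_quadratic c ` J)"
    by (auto simp: constancy_space_def)
qed

text \<open>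
  For every set \<open>J\<close> of colours there is a point on the boundary of exactly the balls of positive
  dimension with colour in \<open>J\<close>: normalise the all-ones vector on each colour class in \<open>J\<close> and
  take zero elsewhere. Balls of dimension 0 do not change the number of coordinates left free.
\<close>

lemma signature_balls:
  fixes c :: "nat \<Rightarrow> nat" and N K :: nat
  defines "qs \<equiv> map (ball_quadratic c) [1..<Suc K]"
  shows "facial_dimension_signature (solution_set N qs) =
           (\<lambda>J. card {j. j < N \<and> c j \<notin> J}) ` Pow {1..K}"
proof -
  have set_qs: "set qs = ball_quadratic c ` {1..K}"
    by (simp add: qs_def atLeastLessThanSuc_atLeastAtMost del: upt_Suc)
  have qs: "\<forall>q\<in>set qs. convex_quadratic N q"
    by (simp add: set_qs convex_quadratic_ball)
  define sphere where
    "sphere x = {i \<in> {1..K}. quad_eval N (ball_quadratic c i) x = 0}" for x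
  have "active N qs x = ball_quadratic c ` sphere x" for x
    by (auto simp: active_def set_qs sphere_def)
  then have dim: "dim (constancy_space N (active N qs x)) = card {j. j < N \<and> c j \<notin> sphere x}" for x
    by (simp only: constancy_space_balls) (subst dim_coordinate_subspace, auto)
  have free_sphere: "\<exists>x\<in>solution_set N qs. {j. j < N \<and> c j \<notin> sphere x} = {j. j < N \<and> c j \<notin> J}"
    if J: "J \<subseteq> {1..K}" for J
  proof -
    define cls where "cls i = {j. j < N \<and> c j = i}" for i
    define g where "g j = (if j < N \<and> c j \<in> J then 1 / sqrt (card (cls (c j))) else 0)" for j
    define x where "x = Abs_poly_mapping g"
    have lookup: "Poly_Mapping.lookup x j = g j" for j
      unfolding x_def by (subst lookup_Abs_poly_mapping)
        (auto intro: finite_subset[of _ "{..<N}"] simp: g_def split: if_splits)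
    have fin: "finite (cls i)" for i
      by (simp add: cls_def)
    have "(\<Sum>j\<in>cls i. (g j)\<^sup>2) = (\<Sum>j\<in>cls i. if i \<in> J then 1 / card (cls i) else 0)" for i
      by (rule sum.cong) (auto simp: cls_def g_def power_divide)
    then have "(\<Sum>j\<in>cls i. (g j)\<^sup>2) = (if i \<in> J \<and> cls i \<noteq> {} then 1 else 0)" for i
      using fin[of i] by simp
    then have eval: "quad_eval N (ball_quadratic c i) x = (if i \<in> J \<and> cls i \<noteq> {} then 0 else - 1)" for i
      by (simp add: quad_eval_ball lookup flip: cls_def)
    have "x \<in> solution_set N qs"
      by (auto simp: solution_set_def set_qs eval Rn_iff lookup g_def)
    moreover have "sphere x = {i \<in> J. cls i \<noteq> {}}"
      using J by (auto simp: sphere_def eval split: if_splits)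
    then have "{j. j < N \<and> c j \<notin> sphere x} = {j. j < N \<and> c j \<notin> J}"
      by (auto simp: cls_def)
    ultimately show ?thesis
      by blast
  qed
  have sphere: "sphere x \<in> Pow {1..K}" for x
    by (auto simp: sphere_def)
  show ?thesis
    unfolding facial_dimension_signature_solution_set[OF qs] dim
  proof (intro equalityI image_subsetI)
    fix x
    show "card {j. j < N \<and> c j \<notin> sphere x} \<in> (\<lambda>J. card {j. j < N \<and> c j \<notin> J}) ` Pow {1..K}"
      using sphere by (rule image_eqI[OF refl])
  next
    fix J assume "J \<in> Pow {1..K}"
    then obtain x where x: "x \<in> solution_set N qs"
      and "{j. j < N \<and> c j \<notin> sphere x} = {j. j < N \<and> c j \<notin> J}"
      using free_sphere by (meson PowD)
    then have "card {j. j < N \<and> c j \<notin> J} = card {j. j < N \<and> c j \<notin> sphere x}"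
      by simp
    then show "card {j. j < N \<and> c j \<notin> J} \<in> (\<lambda>x. card {j. j < N \<and> c j \<notin> sphere x}) ` solution_set N qs"
      using x by (rule image_eqI)
  qed
qed

text \<open>
  Colour 0 is the linear factor, colours \<open>1..K\<close> the balls, and the image collects the numbers of
  coordinates left free. Giving the new colour \<open>h\<close> coordinates
  turns the interval \<open>{m..M - h}\<close> of these numbers into its union with its shift \<open>{m + h..M}\<close>;
  with \<open>h\<close> half of \<open>M - m\<close> rounded up, the two intervals leave no gap, and \<open>M - h - m\<close>
  is at most half of \<open>M - m\<close>.
\<close>

lemma interval_colouring:
  assumes "m \<le> M" "M - m < 2 ^ K"
  shows "\<exists>c. (\<forall>j. c j \<le> K) \<and> (\<lambda>J. card {j. j < M \<and> c j \<notin> J}) ` Pow {1..K} = {m..M}"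
  using assms
proof (induction K arbitrary: M)
  case 0
  then show ?case
    by (intro exI[of _ "\<lambda>_. 0"]) auto
next
  case (Suc K)
  define h where "h = (M - m + 1) div 2"
  define M' where "M' = M - h"
  have h: "h \<le> M - m" "M - m \<le> 2 * h" "2 * h \<le> M - m + 1"
    unfolding h_def by presburger+
  have M': "m \<le> M'" "M' - m < 2 ^ K" "M = M' + h" "m + h \<le> M' + 1"
    using h Suc.prems unfolding M'_def by simp_all
  then obtain c where c: "\<And>j. c j \<le> K"
    and img: "(\<lambda>J. card {j. j < M' \<and> c j \<notin> J}) ` Pow {1..K} = {m..M'}"
    using Suc.IH[of M'] by blast
  define c' where "c' j = (if j < M' then c j else Suc K)" for j
  let ?n = "\<lambda>J. card {j. j < M' \<and> c j \<notin> J}" and ?n' = "\<lambda>J. card {j. j < M \<and> c' j \<notin> J}"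
  have without: "?n' J = ?n J + h" if "J \<subseteq> {1..K}" for J
  proof -
    have "{j. j < M \<and> c' j \<notin> J} = {j. j < M' \<and> c j \<notin> J} \<union> {M'..<M}"
      using that M' by (auto simp: c'_def)
    moreover have "card ({j. j < M' \<and> c j \<notin> J} \<union> {M'..<M}) = ?n J + card {M'..<M}"
      by (rule card_Un_disjoint) auto
    ultimately show ?thesis
      using M' by simp
  qed
  have "with": "?n' (insert (Suc K) J) = ?n J" for J
  proof -
    have "c j \<noteq> Suc K" for j
      using c[of j] by simp
    then have "{j. j < M \<and> c' j \<notin> insert (Suc K) J} = {j. j < M' \<and> c j \<notin> J}"
      using M' by (auto simp: c'_def split: if_splits)
    then show ?thesis
      by simp
  qed
  have "{1..Suc K} = insert (Suc K) {1..K}"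
    by auto
  then have "?n' ` Pow {1..Suc K} = ?n' ` Pow {1..K} \<union> (\<lambda>J. ?n' (insert (Suc K) J)) ` Pow {1..K}"
    by (simp only: Pow_insert image_Un image_image)
  also have "\<dots> = (\<lambda>k. k + h) ` (?n ` Pow {1..K}) \<union> ?n ` Pow {1..K}"
    unfolding image_image by (intro arg_cong2[of _ _ _ _ "(\<union>)"] image_cong) (simp_all only: without "with" Pow_iff)
  also have "\<dots> = {m + h..M} \<union> {m..M'}"
    unfolding img using M' by simp
  also have "\<dots> = {m..M}"
    using M' by auto
  finally show ?case
    using c by (intro exI[of _ c']) (auto simp: c'_def intro: le_SucI)
qed

lemma representable_by_interval:
  assumes "m \<le> M" "M - m < 2 ^ K"
  shows "representable_by K {m..M}"
proof -
  obtain c where c: "(\<lambda>J. card {j. j < M \<and> c j \<notin> J}) ` Pow {1..K} = {m..M}"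
    using interval_colouring[OF assms] by blast
  let ?qs = "map (ball_quadratic c) [1..<Suc K]"
  have "length ?qs = K" "\<forall>q\<in>set ?qs. convex_quadratic M q"
    by (auto simp: convex_quadratic_ball)
  then show ?thesis
    using signature_balls[of M c K] c unfolding representable_by_def by metis
qed

section \<open>The minimum number of inequalities\<close>

theorem corollary3p2:
  fixes I :: "nat set"
  assumes "finite I" and "I \<noteq> {}"
    and "I = {Min I..Max I}"
  shows "\<exists>K. int K = \<lceil>log 2 (real (Max I) - real (Min I) + 1)\<rceil> \<and>
             representable_by K I \<and> (\<forall>K'. representable_by K' I \<longrightarrow> K \<le> K')"
proof -
  define m M where "m = Min I" and "M = Max I"
  have I: "I = {m..M}"
    using assms(3) unfolding m_def M_def .
  have mM: "m \<le> M"
    using Min_in[OF assms(1,2)] Max_ge[OF assms(1)] unfolding m_def M_def by blast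
  have card: "card I = M - m + 1"
    using mM by (simp add: I)
  define n where "n = M - m"
  have n: "real M - real m + 1 = real (n + 1)"
    using mM by (simp add: n_def)
  define K where "K = nat \<lceil>log 2 (real (n + 1))\<rceil>"
  have log_nonneg: "0 \<le> \<lceil>log 2 (real (n + 1))\<rceil>"
    using ceiling_mono[of 0 "log 2 (real (n + 1))"] by simp
  have bound: "K \<le> k \<longleftrightarrow> n + 1 \<le> 2 ^ k" for k
  proof -
    have "K \<le> k \<longleftrightarrow> log 2 (real (n + 1)) \<le> real k"
      unfolding K_def by (simp add: nat_le_iff ceiling_le_iff)
    also have "\<dots> \<longleftrightarrow> real (n + 1) \<le> 2 ^ k"
      by (simp add: log_le_iff powr_realpow)
    also have "\<dots> \<longleftrightarrow> n + 1 \<le> 2 ^ k"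
      using of_nat_le_iff[of "n + 1" "2 ^ k", where 'a = real] by simp
    finally show ?thesis .
  qed
  have "representable_by K I"
    unfolding I using mM bound[of K] by (intro representable_by_interval) (auto simp: n_def)
  moreover have "K \<le> K'" if "representable_by K' I" for K'
    using card_representable_by[OF that] card bound by (simp add: n_def)
  moreover have "int K = \<lceil>log 2 (real (Max I) - real (Min I) + 1)\<rceil>"
    using log_nonneg unfolding m_def[symmetric] M_def[symmetric] n K_def by (simp only: nat_0_le)
  ultimately show ?thesis
    by blast
qed

end
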